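(* For all sufficiently large positive integers $n$, and for every integer $\ell$ with $1 \leq \ell \leq n-1$, there exist a positive integer $d$ and an $n \times d$ integer matrix $A$ such that $A$ is a sensing matrix for $\ell$-sparse vectors, $|A| = 2$, and $$d \geq \left( \frac{n+2}{2} \right)^{1 + \frac{2}{3\ell-2}}.$$
   Context: An $n \times d$ real matrix $A$ is a sensing matrix for $\ell$-sparse vectors (signals), $1 \leq \ell \leq n$, if for every nonzero vector $\boldsymbol{x} \in \mathbb{R}^d$ with no more than $\ell$ nonzero coordinates, $A\boldsymbol{x} \neq \boldsymbol{0}$. For an integer matrix $A = (a_{ij})$, $|A| := \max_{i,j} |a_{ij}|$. *)

theory Defs
  imports Complex_Main "Jordan_Normal_Form.Matrix"
begin

definition sensing_matrix :: "nat \<Rightarrow> real mat \<Rightarrow> bool" where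
  "sensing_matrix l A \<longleftrightarrow>
     1 \<le> l \<and> l \<le> dim_row A \<and>
     (\<forall>x \<in> carrier_vec (dim_col A).
        x \<noteq> 0\<^sub>v (dim_col A) \<and> card {i. i < dim_col A \<and> x $ i \<noteq> 0} \<le> l
        \<longrightarrow> A *\<^sub>v x \<noteq> 0\<^sub>v (dim_row A))"

(* The value is unspecified for a matrix with no rows or no columns. *)
definition max_abs_entry :: "int mat \<Rightarrow> int" where
  "max_abs_entry A = Max {\<bar>A $$ (i, j)\<bar> | i j. i < dim_row A \<and> j < dim_col A}"

end

theory Submission
  imports Defs
begin

text \<open>For \<open>l \<ge> 2\<close> take the signed incidence vectors of a directed graph on \<open>n\<close> vertices, all doubled.
  Among the graphs of maximum degree at most \<open>q + 1\<close> in which any \<open>l\<close> edge vectors are linearly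
  independent (those of girth greater than \<open>l\<close>), choose one with the most edges.
  Two vertices of degree at most \<open>q\<close> are then at distance at most \<open>l - 1\<close>, as otherwise they could be
  joined. Hence all but at most \<open>2 q ^ (l - 1)\<close> vertices have degree \<open>q + 1\<close>. With
  \<open>N = (n + 2) / 2\<close> and \<open>x = N powr (2 / (3 l - 2))\<close>, the choice \<open>q = \<lfloor>5 x / 4\<rfloor>\<close> gives at least \<open>N x\<close> edges
  unless \<open>x \<le> 19/10\<close>, and in that case \<open>N x \<le> n\<close>, so twice the identity matrix suffices. For \<open>l = 1\<close>
  any number of nonzero columns works.\<close>

section \<open>Signed incidence vectors, degrees and balls\<close>

definition edge_vec :: "nat \<times> nat \<Rightarrow> nat \<Rightarrow> int" where
  "edge_vec e w = of_bool (fst e = w) - of_bool (snd e = w)"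

text \<open>For finite \<open>E\<close> this is the absence of undirected cycles of length at most
  \<open>l\<close>, with loops and antiparallel pairs counted as cycles of length 1 and 2. The
  linear form avoids walks and is what the matrix needs.\<close>

definition short_indep :: "nat \<Rightarrow> (nat \<times> nat) set \<Rightarrow> bool" where
  "short_indep l E \<longleftrightarrow> (\<forall>S \<subseteq> E. card S \<le> l \<longrightarrow>
     (\<forall>x :: nat \<times> nat \<Rightarrow> real. (\<forall>w. (\<Sum>e\<in>S. x e * edge_vec e w) = 0) \<longrightarrow> (\<forall>e\<in>S. x e = 0)))"

definition nbrs :: "(nat \<times> nat) set \<Rightarrow> nat \<Rightarrow> nat set" where
  "nbrs E w = {z. (w, z) \<in> E \<or> (z, w) \<in> E}"

text \<open>Ends of arcs are counted, not neighbours, so that \<open>sum_deg\<close> holds even in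
  the presence of loops and antiparallel pairs.\<close>

definition deg :: "(nat \<times> nat) set \<Rightarrow> nat \<Rightarrow> nat" where
  "deg E w = card {e \<in> E. fst e = w} + card {e \<in> E. snd e = w}"

primrec gball :: "(nat \<times> nat) set \<Rightarrow> nat \<Rightarrow> nat \<Rightarrow> nat set" where
  "gball E u 0 = {u}"
| "gball E u (Suc i) = gball E u i \<union> (\<Union>w\<in>gball E u i. nbrs E w)"

lemma short_indepD:
  fixes x :: "nat \<times> nat \<Rightarrow> real"
  assumes "short_indep l E" "S \<subseteq> E" "card S \<le> l"
    and "\<And>w. (\<Sum>e\<in>S. x e * edge_vec e w) = 0" and "e \<in> S"
  shows "x e = 0"
  using assms unfolding short_indep_def by blast

lemma nbrs_eq: "nbrs E w = snd ` {e \<in> E. fst e = w} \<union> fst ` {e \<in> E. snd e = w}"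
  by (force simp: nbrs_def)

lemma finite_nbrs: "finite E \<Longrightarrow> finite (nbrs E w)"
  by (simp add: nbrs_eq)

lemma card_nbrs_le_deg:
  assumes "finite E"
  shows "card (nbrs E w) \<le> deg E w"
proof -
  have "card (nbrs E w) \<le> card (snd ` {e \<in> E. fst e = w}) + card (fst ` {e \<in> E. snd e = w})"
    unfolding nbrs_eq by (rule card_Un_le)
  also have "\<dots> \<le> deg E w"
    unfolding deg_def using assms by (intro add_mono card_image_le) auto
  finally show ?thesis .
qed

lemma finite_gball: "finite E \<Longrightarrow> finite (gball E u i)"
  by (induction i) (auto simp: finite_nbrs)

lemma gball_mono: "i \<le> j \<Longrightarrow> gball E u i \<subseteq> gball E u j"
  by (rule lift_Suc_mono_le[of "gball E u"]) auto

lemma center_in_gball: "u \<in> gball E u i"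
  by (induction i) auto

lemma edge_in_gball_Suc:
  assumes "e \<in> E" "fst e \<in> gball E u i \<or> snd e \<in> gball E u i"
  shows "fst e \<in> gball E u (Suc i) \<and> snd e \<in> gball E u (Suc i)"
proof (cases e)
  case (Pair a b)
  then show ?thesis using assms by (auto simp: nbrs_def)
qed

section \<open>Short dependencies and distance\<close>

lemma sum_edge_vec:
  assumes "finite K"
  shows "(\<Sum>w\<in>K. edge_vec e w) = of_bool (fst e \<in> K) - of_bool (snd e \<in> K)"
  using assms by (simp add: edge_vec_def sum_subtractf of_bool_def)

text \<open>Adding up the coordinates in \<open>K\<close> kills every edge that does not cross the
  cut, hence all of \<open>T\<close>, while \<open>(u, v)\<close> contributes 1.\<close>

lemma cut_dependency_eq_0:
  fixes x :: "nat \<times> nat \<Rightarrow> real" and c :: real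
  assumes "finite T" "finite K" "u \<in> K" "v \<notin> K"
    and T: "\<And>e. e \<in> T \<Longrightarrow> fst e \<in> K \<longleftrightarrow> snd e \<in> K"
    and dep: "\<And>w. c * edge_vec (u, v) w + (\<Sum>e\<in>T. x e * edge_vec e w) = 0"
  shows "c = 0"
proof -
  have *: "(\<Sum>w\<in>K. real_of_int (edge_vec e w)) = of_bool (fst e \<in> K) - of_bool (snd e \<in> K)" for e
    using sum_edge_vec[OF \<open>finite K\<close>, of e, THEN arg_cong[of _ _ real_of_int]] by simp
  have "0 = (\<Sum>w\<in>K. c * edge_vec (u, v) w + (\<Sum>e\<in>T. x e * edge_vec e w))"
    using dep by simp
  also have "\<dots> = c * (\<Sum>w\<in>K. real_of_int (edge_vec (u, v) w))
      + (\<Sum>e\<in>T. x e * (\<Sum>w\<in>K. real_of_int (edge_vec e w)))"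
    unfolding sum.distrib sum_distrib_left by (subst sum.swap[of _ T]) simp
  also have "\<dots> = c"
    unfolding * using assms(3,4) T by (simp add: sum.neutral)
  finally show ?thesis by simp
qed

text \<open>In graph terms, a new short cycle through \<open>(u, v)\<close> leaves a path of length
  at most \<open>l - 1\<close> from \<open>u\<close> to \<open>v\<close>. No path is constructed
  here: the dependency is tested against the cuts given by the balls around
  \<open>u\<close>.\<close>

lemma near_if_not_short_indep_insert:
  assumes E: "short_indep l E" and fin: "finite E"
    and dep: "\<not> short_indep l (insert (u, v) E)"
  shows "v \<in> gball E u (l - 1)"
proof (rule ccontr)
  assume v: "v \<notin> gball E u (l - 1)"
  from dep obtain S x e\<^sub>0 where S: "S \<subseteq> insert (u, v) E" "card S \<le> l"
    and x: "\<And>w. (\<Sum>e\<in>S. x e * real_of_int (edge_vec e w)) = 0" and e\<^sub>0: "e\<^sub>0 \<in> S" "x e\<^sub>0 \<noteq> 0"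
    unfolding short_indep_def by blast
  have uv: "(u, v) \<in> S"
  proof (rule ccontr)
    assume "(u, v) \<notin> S"
    then have "S \<subseteq> E" using S(1) by auto
    then show False using short_indepD[OF E _ S(2) x e\<^sub>0(1)] e\<^sub>0(2) by simp
  qed
  have finS: "finite S"
    using S(1) fin by (meson finite.insertI finite_subset)
  define T where "T = S - {(u, v)}"
  have T: "T \<subseteq> E" "finite T" "card T \<le> l - 1"
    using S uv finS by (auto simp: T_def)
  have split: "x (u, v) * edge_vec (u, v) w + (\<Sum>e\<in>T. x e * edge_vec e w) = 0" for w
    using x[of w] sum.remove[OF finS uv, of "\<lambda>e. x e * edge_vec e w"] by (simp add: T_def)
  have "x (u, v) \<noteq> 0"
  proof
    assume 0: "x (u, v) = 0"
    then have "e\<^sub>0 \<in> T" using e\<^sub>0 by (auto simp: T_def)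
    moreover have "card T \<le> l" using T(3) by simp
    moreover have "(\<Sum>e\<in>T. x e * real_of_int (edge_vec e w)) = 0" for w
      using split[of w] 0 by simp
    ultimately have "x e\<^sub>0 = 0"
      using short_indepD[OF E T(1), of x e\<^sub>0] by simp
    with e\<^sub>0 show False by simp
  qed
  \<comment> \<open>Every ball of radius at most \<open>l - 1\<close> separates \<open>u\<close> from \<open>v\<close>, so some edge of \<open>T\<close> crosses
    its boundary; an edge crosses the boundary of at most one ball, so \<open>T\<close> has too many edges.\<close>
  have "\<exists>e\<in>T. (fst e \<in> gball E u i) \<noteq> (snd e \<in> gball E u i)" if "i \<le> l - 1" for i
  proof (rule ccontr)
    assume "\<not> ?thesis"
    moreover have "v \<notin> gball E u i" using v gball_mono[OF that, of E u] by auto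
    ultimately have "x (u, v) = 0"
      by (intro cut_dependency_eq_0[OF T(2) finite_gball[OF fin] center_in_gball _ _ split, of i]) auto
    with \<open>x (u, v) \<noteq> 0\<close> show False by simp
  qed
  then obtain g where g: "\<And>i. i \<le> l - 1 \<Longrightarrow> g i \<in> T"
    "\<And>i. i \<le> l - 1 \<Longrightarrow> (fst (g i) \<in> gball E u i) \<noteq> (snd (g i) \<in> gball E u i)"
    by metis
  have later: "fst (g i) \<in> gball E u j \<and> snd (g i) \<in> gball E u j" if "i < j" "i \<le> l - 1" for i j
  proof -
    have "fst (g i) \<in> gball E u (Suc i) \<and> snd (g i) \<in> gball E u (Suc i)"
      using g[OF that(2)] T(1) by (intro edge_in_gball_Suc) auto
    then show ?thesis using gball_mono[of "Suc i" j E u] that by auto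
  qed
  have "inj_on g {..l - 1}"
  proof (rule linorder_inj_onI)
    fix i j assume "i < j" "i \<in> {..l - 1}" "j \<in> {..l - 1}"
    then show "g i \<noteq> g j" using later[of i j] g(2)[of j] by auto
  qed auto
  then have "card {..l - 1} \<le> card T"
    using g(1) T(2) by (intro card_inj_on_le[of g]) auto
  then show False using T(3) by simp
qed

section \<open>Growth of balls\<close>

text \<open>A vertex of a sphere has at most \<open>q + 1\<close> neighbours, one of which lies in
  the previous ball, so it leads to at most \<open>q\<close> new vertices. The centre has no
  predecessor, whence the stronger bound on its degree.\<close>

lemma card_sphere_le:
  assumes fin: "finite E" and deg: "\<And>w. deg E w \<le> Suc q" and u: "deg E u \<le> q"
  shows "card (gball E u (Suc i) - gball E u i) \<le> q ^ Suc i"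
proof (induction i)
  case 0
  have "card (gball E u 1 - gball E u 0) \<le> card (nbrs E u)"
    using finite_nbrs[OF fin] by (intro card_mono) auto
  then show ?case using card_nbrs_le_deg[OF fin, of u] u by simp
next
  case (Suc i)
  let ?B = "gball E u"
  let ?D = "?B (Suc i) - ?B i"
  have each: "card (nbrs E w - ?B (Suc i)) \<le> q" if "w \<in> ?D" for w
  proof -
    from that obtain z where "z \<in> ?B i" "w \<in> nbrs E z" by auto
    then have z: "z \<in> nbrs E w" "z \<in> ?B (Suc i)" by (auto simp: nbrs_def)
    have "card (nbrs E w - ?B (Suc i)) < card (nbrs E w)"
      using z finite_nbrs[OF fin] by (intro psubset_card_mono) auto
    then show ?thesis using card_nbrs_le_deg[OF fin, of w] deg[of w] by linarith
  qed
  have "?B (Suc (Suc i)) - ?B (Suc i) \<subseteq> (\<Union>w\<in>?D. nbrs E w - ?B (Suc i))" by auto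
  then have "card (?B (Suc (Suc i)) - ?B (Suc i)) \<le> card (\<Union>w\<in>?D. nbrs E w - ?B (Suc i))"
    using finite_gball[OF fin] finite_nbrs[OF fin] by (intro card_mono) auto
  also have "\<dots> \<le> (\<Sum>w\<in>?D. card (nbrs E w - ?B (Suc i)))"
    using finite_gball[OF fin, of u "Suc i"] by (intro card_UN_le) auto
  also have "\<dots> \<le> card ?D * q"
    using sum_bounded_above[of ?D "\<lambda>w. card (nbrs E w - ?B (Suc i))" q, OF each] by (simp only: of_nat_id)
  also have "\<dots> \<le> q ^ Suc i * q"
    using Suc.IH by (intro mult_right_mono) auto
  finally show ?case by (simp add: mult.commute)
qed

lemma card_gball_le:
  assumes fin: "finite E" and deg: "\<And>w. deg E w \<le> Suc q" and u: "deg E u \<le> q" and q: "2 \<le> q"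
  shows "card (gball E u m) \<le> 2 * q ^ m"
proof (induction m)
  case (Suc m)
  have "gball E u (Suc m) = gball E u m \<union> (gball E u (Suc m) - gball E u m)" by auto
  then have "card (gball E u (Suc m)) \<le> card (gball E u m) + card (gball E u (Suc m) - gball E u m)"
    by (metis card_Un_le)
  also have "\<dots> \<le> 2 * q ^ m + q ^ Suc m"
    using Suc.IH card_sphere_le[OF fin deg u, of m] by linarith
  also have "\<dots> \<le> 2 * q ^ Suc m"
    using mult_right_mono[OF q, of "q ^ m"] by simp
  finally show ?case .
qed simp

section \<open>The extremal graph\<close>

lemma sum_deg:
  assumes "E \<subseteq> {..<n} \<times> {..<n}"
  shows "(\<Sum>w<n. deg E w) = 2 * card E"
proof -
  have fin: "finite E" using assms by (rule finite_subset) simp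
  have "(\<Sum>w<n. card {e \<in> E. fst e = w}) = card E" "(\<Sum>w<n. card {e \<in> E. snd e = w}) = card E"
    using assms sum.group[OF fin finite_lessThan, of fst n "\<lambda>_. 1::nat"]
      sum.group[OF fin finite_lessThan, of snd n "\<lambda>_. 1::nat"]
    by (force simp: image_subset_iff)+
  then show ?thesis by (simp add: deg_def sum.distrib)
qed

text \<open>A loop would raise the degree of its vertex by 2, hence
  \<open>u \<noteq> v\<close>.\<close>

lemma deg_insert_le:
  assumes "finite E" "u \<noteq> v"
  shows "deg (insert (u, v) E) w \<le> deg E w + of_bool (w = u \<or> w = v)"
proof -
  have "{e \<in> insert (u, v) E. fst e = w} = (if w = u then insert (u, v) else id) {e \<in> E. fst e = w}"
    "{e \<in> insert (u, v) E. snd e = w} = (if w = v then insert (u, v) else id) {e \<in> E. snd e = w}"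
    by auto
  then show ?thesis
    using assms by (auto simp: deg_def card_insert_if)
qed

text \<open>The last inequality is 2|E| >= (q + 1)(n - |D|) for the set \<open>D\<close> of vertices
  of degree at most \<open>q\<close>, written without subtraction and with the ball bound in place
  of |D|.\<close>

lemma exists_short_indep_graph:
  assumes q: "2 \<le> q" and l: "2 \<le> l"
  obtains E where "E \<subseteq> {..<n} \<times> {..<n}" "short_indep l E"
    "Suc q * n \<le> 2 * card E + Suc q * (2 * q ^ (l - 1))"
proof -
  define F where "F = {E. E \<subseteq> {..<n} \<times> {..<n} \<and> short_indep l E \<and> (\<forall>w. deg E w \<le> Suc q)}"
  have "F \<subseteq> Pow ({..<n} \<times> {..<n})" by (auto simp: F_def)
  then have "finite F" by (rule finite_subset) simp
  moreover have "{} \<in> F" by (auto simp: F_def short_indep_def deg_def)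
  ultimately have "Max (card ` F) \<in> card ` F" "\<And>E'. E' \<in> F \<Longrightarrow> card E' \<le> Max (card ` F)"
    by (auto intro: Max_in)
  then obtain E where EF: "E \<in> F" and max: "\<And>E'. E' \<in> F \<Longrightarrow> card E' \<le> card E"
    by auto
  then have E: "E \<subseteq> {..<n} \<times> {..<n}" "short_indep l E" and deg: "\<And>w. deg E w \<le> Suc q"
    by (auto simp: F_def)
  have fin: "finite E" using E(1) by (rule finite_subset) simp
  define D where "D = {w. w < n \<and> deg E w \<le> q}"
  have D: "card D \<le> 2 * q ^ (l - 1)"
  proof (cases "D = {}")
    case False
    then obtain u where u: "u < n" "deg E u \<le> q" by (auto simp: D_def)
    have "v \<in> gball E u (l - 1)" if v: "v < n" "deg E v \<le> q" for v
    \<comment> \<open>Here inserting \<open>(u, v)\<close> would create a loop or add nothing, but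
      \<open>v\<close> is within distance 1 of \<open>u\<close>, and \<open>l \<ge> 2\<close> makes
      the radius \<open>l - 1\<close> large enough.\<close>
    proof (cases "v = u \<or> (u, v) \<in> E")
      case True
      then have "v \<in> gball E u 1" by (auto simp: nbrs_def)
      moreover have "1 \<le> l - 1" using l by simp
      ultimately show ?thesis using gball_mono by blast
    next
      case False
      \<comment> \<open>Maximality excludes the larger set from \<open>F\<close>. Both
        \<open>u\<close> and \<open>v\<close> can afford one more edge, so the degree bound survives
        and independence must fail.\<close>
      then have "insert (u, v) E \<notin> F" using max[of "insert (u, v) E"] fin by auto
      moreover have "deg (insert (u, v) E) w \<le> Suc q" for w
        using deg_insert_le[OF fin, of u v w] False deg[of w] u v
        by (cases "w = u \<or> w = v") auto
      ultimately have "\<not> short_indep l (insert (u, v) E)"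
        using u v E(1) by (auto simp: F_def)
      then show ?thesis using near_if_not_short_indep_insert[OF E(2) fin] by blast
    qed
    then have "D \<subseteq> gball E u (l - 1)" by (auto simp: D_def)
    then have "card D \<le> card (gball E u (l - 1))"
      using finite_gball[OF fin] by (rule card_mono[rotated])
    also have "\<dots> \<le> 2 * q ^ (l - 1)" by (rule card_gball_le[OF fin deg u(2) q])
    finally show ?thesis .
  qed simp
  have Dn: "D \<subseteq> {..<n}" "finite D" by (auto simp: D_def)
  have "Suc q * n = (\<Sum>w<n. Suc q)" by simp
  \<comment> \<open>Vertices outside \<open>D\<close> have degree exactly \<open>q + 1\<close>; each
    vertex of \<open>D\<close> is compensated by a full \<open>q + 1\<close>.\<close>
  also have "\<dots> \<le> (\<Sum>w<n. deg E w + (if w \<in> D then Suc q else 0))"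
    using deg by (intro sum_mono) (force simp: D_def)
  also have "\<dots> = 2 * card E + Suc q * card D"
    using Dn by (simp add: sum.distrib sum_deg[OF E(1)] sum.inter_restrict[symmetric] Int_absorb1)
  also have "\<dots> \<le> 2 * card E + Suc q * (2 * q ^ (l - 1))"
    using D by (intro add_left_mono mult_left_mono) auto
  finally show ?thesis using that E by blast
qed

section \<open>Construction of the matrices\<close>

text \<open>Taking \<open>S\<close> to be the support of a sparse kernel vector reduces the claim to
  dependencies among at most \<open>l\<close> columns with no zero coefficient.\<close>

lemma sensing_matrixI:
  assumes A: "A \<in> carrier_mat n d" and l: "1 \<le> l" "l \<le> n"
    and indep: "\<And>S x. S \<subseteq> {..<d} \<Longrightarrow> card S \<le> l \<Longrightarrow>
      (\<And>i. i < n \<Longrightarrow> (\<Sum>j\<in>S. A $$ (i, j) * x j) = 0) \<Longrightarrow> (\<And>j. j \<in> S \<Longrightarrow> x j \<noteq> 0) \<Longrightarrow> S = {}"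
  shows "sensing_matrix l A"
  unfolding sensing_matrix_def
proof (intro conjI ballI impI notI)
  fix x assume x: "x \<in> carrier_vec (dim_col A)"
    and nz: "x \<noteq> 0\<^sub>v (dim_col A) \<and> card {i. i < dim_col A \<and> x $ i \<noteq> 0} \<le> l"
    and Ax: "A *\<^sub>v x = 0\<^sub>v (dim_row A)"
  define S where "S = {i. i < d \<and> x $ i \<noteq> 0}"
  have "(\<Sum>j\<in>S. A $$ (i, j) * x $ j) = 0" if i: "i < n" for i
  proof -
    have "(\<Sum>j\<in>S. A $$ (i, j) * x $ j) = (\<Sum>j\<in>{0..<d}. A $$ (i, j) * x $ j)"
      by (rule sum.mono_neutral_left) (auto simp: S_def)
    also have "\<dots> = (A *\<^sub>v x) $ i"
      using A x i by (simp add: scalar_prod_def)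
    finally show ?thesis using Ax A i by simp
  qed
  then have "S = {}"
    using nz A by (intro indep[of S "\<lambda>j. x $ j"]) (auto simp: S_def)
  then have "x = 0\<^sub>v d"
    using x A by (intro eq_vecI) (auto simp: S_def)
  then show False using nz A by auto
qed (use A l in auto)

lemma max_abs_entry_eqI:
  assumes A: "A \<in> carrier_mat n d"
    and le: "\<And>i j. i < n \<Longrightarrow> j < d \<Longrightarrow> \<bar>A $$ (i, j)\<bar> \<le> m"
    and eq: "i < n" "j < d" "\<bar>A $$ (i, j)\<bar> = m"
  shows "max_abs_entry A = m"
proof -
  have "{\<bar>A $$ (i, j)\<bar> | i j. i < dim_row A \<and> j < dim_col A}
      = (\<lambda>(i, j). \<bar>A $$ (i, j)\<bar>) ` ({..<n} \<times> {..<d})"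
    using A by force
  moreover have "Max ((\<lambda>(i, j). \<bar>A $$ (i, j)\<bar>) ` ({..<n} \<times> {..<d})) = m"
    using le eq by (intro Max_eqI) force+
  ultimately show ?thesis by (simp add: max_abs_entry_def)
qed

lemma sensing_matrix_of_graph:
  assumes E: "E \<subseteq> {..<n} \<times> {..<n}" "short_indep l E" and ne: "E \<noteq> {}" and l: "1 \<le> l" "l \<le> n"
  shows "\<exists>A \<in> carrier_mat n (card E). sensing_matrix l (map_mat real_of_int A) \<and> max_abs_entry A = 2"
proof -
  have fin: "finite E" using E(1) by (rule finite_subset) simp
  obtain f where f: "bij_betw f {0..<card E} E"
    using ex_bij_betw_nat_finite[OF fin] by blast
  define A where "A = mat n (card E) (\<lambda>(i, j). 2 * edge_vec (f j) i)"
  have A: "A \<in> carrier_mat n (card E)" by (simp add: A_def)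
  have fE: "f j \<in> E" if "j < card E" for j
    using f that by (auto dest: bij_betwE)
  have "sensing_matrix l (map_mat real_of_int A)"
  proof (rule sensing_matrixI[OF _ l])
    fix S and x :: "nat \<Rightarrow> real"
    assume S: "S \<subseteq> {..<card E}" "card S \<le> l"
      and dep: "\<And>i. i < n \<Longrightarrow> (\<Sum>j\<in>S. map_mat real_of_int A $$ (i, j) * x j) = 0"
      and nz: "\<And>j. j \<in> S \<Longrightarrow> x j \<noteq> 0"
    have inj: "inj_on f S"
      using f S(1) by (auto simp: bij_betw_def lessThan_atLeast0 intro: inj_on_subset)
    \<comment> \<open>The coefficients are moved from column indices to edges.\<close>
    define y where "y = x \<circ> the_inv_into S f"
    have y: "y (f j) = x j" if "j \<in> S" for j
      using inj that by (simp add: y_def the_inv_into_f_f)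
    have "(\<Sum>e\<in>f ` S. y e * edge_vec e w) = 0" for w
    proof -
      have eq: "(\<Sum>e\<in>f ` S. y e * edge_vec e w) = (\<Sum>j\<in>S. x j * edge_vec (f j) w)"
        using y by (simp add: sum.reindex[OF inj])
      show ?thesis
      proof (cases "w < n")
        case True
        have "2 * (\<Sum>j\<in>S. x j * edge_vec (f j) w)
            = (\<Sum>j\<in>S. map_mat real_of_int A $$ (w, j) * x j)"
          unfolding sum_distrib_left using S(1) True by (intro sum.cong) (auto simp: A_def)
        then show ?thesis using dep[OF True] eq by simp
      next
        case False
        \<comment> \<open>\<open>short_indep\<close> asks for all coordinates \<open>w\<close>, the
          matrix has only the rows below \<open>n\<close>; the others vanish since all edges end
          below \<open>n\<close>.\<close>
        have "edge_vec (f j) w = 0" if "j \<in> S" for j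
          using fE[of j] S(1) that E(1) False by (force simp: edge_vec_def)
        then show ?thesis using eq by simp
      qed
    qed
    moreover have "f ` S \<subseteq> E" using fE S(1) by auto
    moreover have "card (f ` S) \<le> l" using S(2) inj by (simp add: card_image)
    ultimately have "y e = 0" if "e \<in> f ` S" for e
      using short_indepD[OF E(2), of "f ` S" y e] that by simp
    then show "S = {}" using y nz by auto
  qed (use A in auto)
  moreover have "max_abs_entry A = 2"
  proof -
    have d: "0 < card E" using ne fin by (simp add: card_gt_0_iff)
    \<comment> \<open>A loop has edge vector 0 and would be a dependent singleton. Hence column 0
      really has an entry 2 in row \<open>fst (f 0)\<close>.\<close>
    have noloop: "fst (f 0) \<noteq> snd (f 0)"
    proof
      assume "fst (f 0) = snd (f 0)"
      then have "(\<Sum>e\<in>{f 0}. 1 * real_of_int (edge_vec e w)) = 0" for w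
        by (simp add: edge_vec_def)
      then have "(1::real) = 0"
        using short_indepD[OF E(2), of "{f 0}" "\<lambda>_. 1" "f 0"] fE[OF d] l by auto
      then show False by simp
    qed
    have "fst (f 0) < n" using fE[OF d] E(1) by auto
    with noloop d show ?thesis
      by (intro max_abs_entry_eqI[OF A, of 2 "fst (f 0)" 0]) (auto simp: A_def edge_vec_def)
  qed
  ultimately show ?thesis using A by blast
qed

lemma sensing_matrix_identity:
  assumes "1 \<le> l" "l \<le> n"
  shows "\<exists>A \<in> carrier_mat n n. sensing_matrix l (map_mat real_of_int A) \<and> max_abs_entry A = 2"
proof (intro bexI conjI)
  let ?A = "mat n n (\<lambda>(i, j). if i = j then 2 else 0) :: int mat"
  show "?A \<in> carrier_mat n n" by simp
  show "max_abs_entry ?A = 2"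
    using assms by (intro max_abs_entry_eqI[of _ n n _ 0 0]) auto
  show "sensing_matrix l (map_mat real_of_int ?A)"
  proof (rule sensing_matrixI[OF _ assms])
    fix S and x :: "nat \<Rightarrow> real"
    assume S: "S \<subseteq> {..<n}" and nz: "\<And>j. j \<in> S \<Longrightarrow> x j \<noteq> 0"
      and dep: "\<And>i. i < n \<Longrightarrow> (\<Sum>j\<in>S. map_mat real_of_int ?A $$ (i, j) * x j) = 0"
    have fin: "finite S" using S by (rule finite_subset) simp
    have False if "i \<in> S" for i
    proof -
      have i: "i < n" using S that by auto
      have "(\<Sum>j\<in>S. map_mat real_of_int ?A $$ (i, j) * x j) = (\<Sum>j\<in>S. if i = j then 2 * x j else 0)"
        using S i by (intro sum.cong) auto
      then show False using dep[OF i] nz that fin by simp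
    qed
    then show "S = {}" by blast
  qed simp
qed

lemma sensing_matrix_one:
  assumes "1 \<le> n" "1 \<le> d"
  shows "\<exists>A \<in> carrier_mat n d. sensing_matrix 1 (map_mat real_of_int A) \<and> max_abs_entry A = 2"
proof (intro bexI conjI)
  let ?A = "mat n d (\<lambda>_. 2) :: int mat"
  show "?A \<in> carrier_mat n d" by simp
  show "max_abs_entry ?A = 2"
    using assms by (intro max_abs_entry_eqI[of _ n d _ 0 0]) auto
  show "sensing_matrix 1 (map_mat real_of_int ?A)"
  proof (rule sensing_matrixI[of _ n d])
    fix S and x :: "nat \<Rightarrow> real"
    assume S: "S \<subseteq> {..<d}" "card S \<le> 1" and nz: "\<And>j. j \<in> S \<Longrightarrow> x j \<noteq> 0"
      and dep: "\<And>i. i < n \<Longrightarrow> (\<Sum>j\<in>S. map_mat real_of_int ?A $$ (i, j) * x j) = 0"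
    have "finite S" using S(1) by (rule finite_subset) simp
    then consider "S = {}" | j where "S = {j}"
      using S(2) by (metis One_nat_def card_1_singletonE card_0_eq le_Suc_eq le_zero_eq)
    then show "S = {}"
      using dep[of 0] nz S(1) assms by cases auto
  qed (use assms in auto)
qed

section \<open>Numerical estimates and choice of parameters\<close>

text \<open>This makes the ball bound 2 q^(l-1) at most N/5 when q <= 5x/4. Since N = x^((3l-2)/2) =
  x^(l-1) * x^(l/2), dividing by x^(l-1) leaves the inequality \<open>x_half\<close>.\<close>

lemma growth_bound:
  fixes N x :: real and l :: nat
  assumes l: "2 \<le> l" and N: "(10 * (5/4) ^ 25) ^ 3 \<le> N"
    and x: "x = N powr (2 / (3 * real l - 2))" "19/10 < x"
  shows "10 * (5/4 * x) ^ (l - 1) \<le> N"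
proof -
  have N0: "0 < N" using N by (rule less_le_trans[rotated]) simp
  have den: "3 * real l - 2 > 0" using l by simp
  \<comment> \<open>For large \<open>l\<close> this holds since \<open>sqrt x > 11/8 = 11/10 * (5/4)\<close>, and for small \<open>l\<close> since
    \<open>x powr (l / 2) \<ge> N powr (1/3)\<close>.\<close>
  have x_half: "10 * (5/4) ^ (l - 1) \<le> x powr (real l / 2)"
  proof (cases "25 \<le> l")
    case True
    have "(11/8)\<^sup>2 \<le> x"
      using x(2) by (simp add: power2_eq_square)
    then have "11/8 \<le> sqrt x"
      by (rule real_le_rsqrt)
    \<comment> \<open>25 is the least exponent for which this holds, which fixes where the cases are
      split.\<close>
    have "(10::real) \<le> (11/10) ^ 25"
      by (simp add: power_divide)
    also have "\<dots> \<le> (11/10) ^ l"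
      using True by (intro power_increasing) auto
    finally have "10 * (5/4) ^ (l - 1) \<le> (11/10) ^ l * (5/4 :: real) ^ l"
      by (intro mult_mono power_increasing) auto
    also have "\<dots> = (11/8) ^ l"
      by (simp flip: power_mult_distrib)
    also have "\<dots> \<le> sqrt x ^ l"
      using \<open>11/8 \<le> sqrt x\<close> by (intro power_mono) auto
    also have "\<dots> = x powr (real l / 2)"
      using x(2) by (simp add: powr_half_sqrt[symmetric] powr_powr flip: powr_realpow)
    finally show ?thesis .
  next
    case False
    \<comment> \<open>The assumed lower bound on \<open>N\<close> is the cube of this right-hand
      side.\<close>
    then have "10 * (5/4) ^ (l - 1) \<le> 10 * (5/4 :: real) ^ 25"
      by (intro mult_left_mono power_increasing) auto
    also have "\<dots> = ((10 * (5/4) ^ 25) ^ 3) powr (1/3)"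
      using powr_powr[of "10 * (5/4) ^ 25 :: real" 3 "1/3"] by (subst powr_numeral[symmetric]) auto
    also have "\<dots> \<le> N powr (1/3)"
      using N by (intro powr_mono2) auto
    also have "\<dots> \<le> N powr (2 / (3 * real l - 2) * (real l / 2))"
    proof (rule powr_mono)
      show "1/3 \<le> 2 / (3 * real l - 2) * (real l / 2)"
        using den by (simp add: field_simps)
      have "(1::real) \<le> (10 * (5/4) ^ 25) ^ 3" by (simp add: power_divide)
      then show "1 \<le> N" using N by linarith
    qed
    also have "\<dots> = x powr (real l / 2)"
      by (simp add: x(1) powr_powr)
    finally show ?thesis .
  qed
  have "N = x powr ((3 * real l - 2) / 2)"
    using den N0 by (simp add: x powr_powr)
  also have "(3 * real l - 2) / 2 = real (l - 1) + real l / 2"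
    using l by (simp add: of_nat_diff field_simps)
  also have "x powr \<dots> = x ^ (l - 1) * x powr (real l / 2)"
    using x(2) by (simp add: powr_add powr_realpow)
  finally have "N = x ^ (l - 1) * x powr (real l / 2)" .
  moreover have "x ^ (l - 1) * (10 * (5/4) ^ (l - 1)) \<le> x ^ (l - 1) * x powr (real l / 2)"
    using x_half x(2) by (intro mult_left_mono) auto
  ultimately show ?thesis by (simp add: power_mult_distrib mult_ac power_divide)
qed

lemma exists_sensing_matrix:
  fixes n l :: nat
  defines "N \<equiv> (real n + 2) / 2"
  assumes N: "(10 * (5/4) ^ 25) ^ 3 \<le> N" and l: "1 \<le> l" "l \<le> n"
  shows "\<exists>d > 0. \<exists>A \<in> carrier_mat n d. sensing_matrix l (map_mat real_of_int A) \<and>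
    max_abs_entry A = 2 \<and> N powr (1 + 2 / (3 * real l - 2)) \<le> real d"
proof -
  have "(100::real) \<le> (10 * (5/4) ^ 25) ^ 3" by (simp add: power_divide)
  with N have N100: "100 \<le> N" by linarith
  have nN: "real n = 2 * N - 2" by (simp add: N_def field_simps)
  show ?thesis
  proof (cases "l = 1")
    case True
    \<comment> \<open>For \<open>l = 1\<close> the exponent 1 + 2/(3l - 2) equals 3.\<close>
    define d where "d = nat \<lceil>N powr 3\<rceil>"
    have "1 \<le> N powr 3" using N100 by (intro ge_one_powr_ge_zero) auto
    then have "N powr 3 \<le> real d" "0 < d" by (auto simp: d_def)
    then show ?thesis
      using sensing_matrix_one[of n d] l True by auto
  next
    case False
    then have l2: "2 \<le> l" using l by simp
    define x where "x = N powr (2 / (3 * real l - 2))"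
    have goal_eq: "N powr (1 + 2 / (3 * real l - 2)) = N * x"
      using N100 by (simp add: x_def powr_add)
    show ?thesis
    proof (cases "x \<le> 19/10")
      case True
      have "N * x \<le> N * (19/10)" using True N100 by (intro mult_left_mono) auto
      \<comment> \<open>As n = 2N - 2, any constant below 2 would do for large \<open>N\<close>;
        19/10 requires N >= 20.\<close>
      also have "\<dots> \<le> real n" using nN N100 by simp
      finally show ?thesis
        unfolding goal_eq using sensing_matrix_identity[OF l] l by (intro exI[of _ n]) auto
    next
      case False
      then have x: "19/10 < x" by simp
      define q where "q = nat \<lfloor>5/4 * x\<rfloor>"
      \<comment> \<open>Indeed 5/4 * 19/10 = 19/8 > 2.\<close>
      have "2 \<le> \<lfloor>5/4 * x\<rfloor>" using x by (simp add: le_floor_iff)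
      then have q: "2 \<le> q" "real q \<le> 5/4 * x" "5/4 * x \<le> real (Suc q)"
        unfolding q_def by linarith+
      obtain E where E: "E \<subseteq> {..<n} \<times> {..<n}" "short_indep l E"
        "Suc q * n \<le> 2 * card E + Suc q * (2 * q ^ (l - 1))"
        by (rule exists_short_indep_graph[OF q(1) l2])
      define b where "b = real q ^ (l - 1)"
      have "b \<le> (5/4 * x) ^ (l - 1)"
        unfolding b_def using q(2) by (intro power_mono) auto
      then have b: "10 * b \<le> N"
        using growth_bound[OF l2 N x_def x] by simp
      have "real (Suc q * n) \<le> real (2 * card E + Suc q * (2 * q ^ (l - 1)))"
        using E(3) of_nat_le_iff by blast
      then have "real (Suc q) * (real n - 2 * b) \<le> 2 * real (card E)"
        by (simp add: b_def algebra_simps)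
      \<comment> \<open>From 10b <= N one gets n - 2b >= 2N - 2 - N/5 >= 8N/5. The factor 5/4 in
        \<open>q\<close> makes up for this loss: the left side is 2Nx, and the 2 cancels against the
        double count of edges.\<close>
      moreover have "5/4 * x * (8/5 * N) \<le> real (Suc q) * (real n - 2 * b)"
        using q(3) b nN N100 x by (intro mult_mono) auto
      ultimately have d: "N * x \<le> real (card E)" by simp
      moreover have "0 < N * x" using N100 x by simp
      ultimately have "0 < card E" by linarith
      then show ?thesis
        unfolding goal_eq using sensing_matrix_of_graph[OF E(1,2) _ l] d
        by (intro exI[of _ "card E"]) force
    qed
  qed
qed

theorem theorem1p1:
  shows "\<forall>\<^sub>F n in sequentially. \<forall>l::nat. 1 \<le> l \<and> l \<le> n - 1 \<longrightarrow>
    (\<exists>d > 0. \<exists>A \<in> carrier_mat n d.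
       sensing_matrix l (map_mat real_of_int A) \<and>
       max_abs_entry A = 2 \<and>
       real d \<ge> ((real n + 2) / 2) powr (1 + 2 / (3 * real l - 2)))"
proof -
  \<comment> \<open>The threshold on \<open>N\<close> does not depend on \<open>l\<close>, so one
    bound on \<open>n\<close> serves all \<open>l\<close> at once.\<close>
  have "\<forall>\<^sub>F n in sequentially. C \<le> (real n + 2) / 2" for C :: real
    using filterlim_real_sequentially[unfolded filterlim_at_top, rule_format, of "2 * C"]
    by (rule eventually_mono) simp
  from this[of "(10 * (5/4) ^ 25) ^ 3"] show ?thesis
    by (rule eventually_mono) (use exists_sensing_matrix in auto)
qed

end
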